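(* For a function $f:\mathbb{Z}^n\to\mathbb{R}\cup\{+\infty\}$, the following properties are equivalent. (1) $f$ is DDM-convex. (2) $\operatorname{dom} f$ is a DDM-convex set, and $f(x)+f(y)\ge f(\mu(x,y))+f(\mu(y,x))$ holds for all $x,y\in\mathbb{Z}^n$ with $\|x-y\|_\infty=2$. (3) For every $x,y\in\operatorname{dom} f$ and every subset $J\subseteq\{1,\dots,m\}$, where $m=\|y-x\|_\infty$, setting $d=\sum_{k\in J}(\mathbf{1}_{A_k}-\mathbf{1}_{B_k})$, one has $f(x)+f(y)\ge f(x+d)+f(y-d)$. (4) For every $x,y\in\operatorname{dom} f$, with $m=\|y-x\|_\infty$, one has $$f(x)+f(y)\ge f(x+\mathbf{1}_{A_m}-\mathbf{1}_{B_m})+f(y-\mathbf{1}_{A_m}+\mathbf{1}_{B_m}).$$ (5) For every $x,y\in\operatorname{dom} f$ and every $\alpha\in\{1,\dots,m\}$, where $m=\|y-x\|_\infty$, setting $d=\sum_{k=1}^{\alpha}(\mathbf{1}_{A_k}-\mathbf{1}_{B_k})$, one has $f(x)+f(y)\ge f(x+d)+f(y-d)$.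
   Context: $\operatorname{dom} f=\{x\in\mathbb{Z}^n\mid f(x)<+\infty\}$. For $A\subseteq\{1,\dots,n\}$, $\mathbf{1}_A\in\{0,1\}^n$ is the characteristic vector of $A$. For a pair $(x,y)\in\mathbb{Z}^n\times\mathbb{Z}^n$ with $m=\|y-x\|_\infty$, the sets $A_k=\{i\mid y_i-x_i\ge k\}$ and $B_k=\{i\mid y_i-x_i\le -k\}$ are defined for $k=1,\dots,m$. (When $x=y$, i.e. $m=0$, there is nothing to require in (3), (4) and (5).) For $x,y\in\mathbb{Z}^n$, the vector $\mu(x,y)\in\mathbb{Z}^n$ is defined componentwise by $\mu(x,y)_i=\lceil (x_i+y_i)/2\rceil$ if $x_i\ge y_i$, and $\mu(x,y)_i=\lfloor (x_i+y_i)/2\rfloor$ if $x_i<y_i$. A function $f:\mathbb{Z}^n\to\mathbb{R}\cup\{+\infty\}$ is called DDM-convex if $f(x)+f(y)\ge f(\mu(x,y))+f(\mu(y,x))$ for all $x,y\in\mathbb{Z}^n$. A set $S\subseteq\mathbb{Z}^n$ is a DDM-convex set if $x,y\in S$ implies $\mu(x,y),\mu(y,x)\in S$. *)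

theory Defs
  imports "HOL-Analysis.Analysis"
begin

(* Points of Z^n have type int ^ 'n with n = CARD('n).  Functions into the reals extended by
   +infinity are ereal-valued; that -infinity is not attained is left to be assumed where
   such a function is introduced. *)

definition effective_domain :: "(int ^ 'n \<Rightarrow> ereal) \<Rightarrow> (int ^ 'n) set" where
  "effective_domain f = {x. f x < \<infinity>}"

(* The library's infnorm is restricted to Euclidean spaces and hence not available on int ^ 'n. *)
definition linf_norm :: "int ^ 'n \<Rightarrow> int" where
  "linf_norm x = Max (range (\<lambda>i. \<bar>x $ i\<bar>))"

definition char_vec :: "'n set \<Rightarrow> int ^ 'n" where
  "char_vec A = (\<chi> i. indicator A i)"

definition A_set :: "int ^ 'n \<Rightarrow> int ^ 'n \<Rightarrow> int \<Rightarrow> 'n set" where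
  "A_set x y k = {i. y $ i - x $ i \<ge> k}"

definition B_set :: "int ^ 'n \<Rightarrow> int ^ 'n \<Rightarrow> int \<Rightarrow> 'n set" where
  "B_set x y k = {i. y $ i - x $ i \<le> - k}"

definition mu :: "int ^ 'n \<Rightarrow> int ^ 'n \<Rightarrow> int ^ 'n" where
  "mu x y = (\<chi> i. if x $ i \<ge> y $ i
                  then \<lceil>(real_of_int (x $ i) + real_of_int (y $ i)) / 2\<rceil>
                  else \<lfloor>(real_of_int (x $ i) + real_of_int (y $ i)) / 2\<rfloor>)"

definition DDM_convex :: "(int ^ 'n \<Rightarrow> ereal) \<Rightarrow> bool" where
  "DDM_convex f \<longleftrightarrow> (\<forall>x y. f x + f y \<ge> f (mu x y) + f (mu y x))"

definition DDM_convex_set :: "(int ^ 'n) set \<Rightarrow> bool" where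
  "DDM_convex_set S \<longleftrightarrow> (\<forall>x\<in>S. \<forall>y\<in>S. mu x y \<in> S \<and> mu y x \<in> S)"

end

theory Submission
  imports Defs
begin

text \<open>
  Fix two points \<open>x\<close>, \<open>y\<close> at distance \<open>m\<close>.  The vectors \<open>1_{A_k} - 1_{B_k}\<close> for
  \<open>k = 1, ..., m\<close> add up to \<open>y - x\<close>, so adding those with \<open>k \<in> S\<close> to \<open>x\<close> maps the
  subsets \<open>S\<close> of \<open>{1..m}\<close> to points between \<open>x\<close> (the image of the empty set) and \<open>y\<close> (the
  image of \<open>{1..m}\<close>).  Let \<open>F S\<close> be the value of \<open>f\<close> at the image of \<open>S\<close>.  Every inequality
  in the theorem has the form \<open>F J + F ({1..m} - J) \<le> F {} + F {1..m}\<close>: the properties of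
  exchange type take for \<open>J\<close> all sets, only the top level \<open>{m}\<close>, or the nonempty initial
  segments, and, since \<open>mu\<close> halves each difference with rounding toward its first argument,
  midpoint convexity takes the set of even levels.

  The picture is hereditary.  For \<open>S \<subseteq> T\<close>, the levels of the pair of points belonging to \<open>S\<close>
  and \<open>T\<close> are the levels in \<open>T - S\<close>, renumbered in increasing order
  (\<open>partial_step_relevel\<close>).  In particular their distance is the number of elements of
  \<open>T - S\<close>, so the inequality for pairs at distance 2 says that \<open>F\<close> is locally supermodular,
  \<open>F (S \<union> {a}) + F (S \<union> {b}) \<le> F S + F (S \<union> {a, b})\<close>.  Where \<open>F\<close> is finite, local
  supermodularity adds up to global supermodularity (\<open>supermodular_of_local\<close>), which contains
  the inequality for all \<open>J\<close>.

  What remains is to see that \<open>F\<close> is finite on all subsets of \<open>{1..m}\<close> as soon as \<open>x\<close> and \<open>y\<close> lie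
  in the domain.  This holds because the domain contains all points between two of its members
  once each pair at distance at least 2 can be split into two further members by some set of
  levels that is neither empty nor full (\<open>partial_steps_in_set\<close>).  If the domain is closed
  under \<open>mu\<close>, the even levels split; so the local midpoint property implies the inequality for
  all \<open>J\<close> (\<open>exchange_of_norm_2\<close>).  If the inequality for the top level is assumed, the top
  level splits; so the domain is closed under \<open>mu\<close>, and the local midpoint property follows,
  because at distance 2 the only even level is the top one.

  The inequality for the top level follows in turn from that for initial segments, because
  \<open>{1..m - 1}\<close> is the complement of \<open>{m}\<close> and complementary sets give the same inequality.
  The other implications of the cycle are specializations.
\<close>

section \<open>Level decomposition of a difference\<close>

definition level_step :: "int ^ 'n \<Rightarrow> int ^ 'n \<Rightarrow> int \<Rightarrow> int ^ 'n" where
  "level_step x y k = char_vec (A_set x y k) - char_vec (B_set x y k)"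

definition partial_step :: "int ^ 'n \<Rightarrow> int ^ 'n \<Rightarrow> int set \<Rightarrow> int ^ 'n" where
  "partial_step x y J = (\<Sum>k\<in>J. level_step x y k)"

lemma abs_nth_le_linf_norm: "\<bar>x $ i\<bar> \<le> linf_norm x"
  unfolding linf_norm_def by (rule Max_ge) auto

lemma linf_norm_attained: "\<exists>i. \<bar>x $ i\<bar> = linf_norm x"
proof -
  have "linf_norm x \<in> range (\<lambda>i. \<bar>x $ i\<bar>)"
    unfolding linf_norm_def by (rule Max_in) auto
  then show ?thesis by auto
qed

lemma linf_norm_nonneg: "0 \<le> linf_norm x"
  using linf_norm_attained[of x] by (metis abs_ge_zero)

lemma linf_norm_minus_commute: "linf_norm (x - y) = linf_norm (y - x)"
  unfolding linf_norm_def by (simp add: abs_minus_commute)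

lemma linf_norm_pos: "x \<noteq> y \<Longrightarrow> 1 \<le> linf_norm (y - x)"
proof -
  assume "x \<noteq> y"
  then obtain i where "x $ i \<noteq> y $ i" by (auto simp: vec_eq_iff)
  then have "0 < \<bar>(y - x) $ i\<bar>" by simp
  with abs_nth_le_linf_norm[of "y - x" i] show ?thesis by linarith
qed

lemma level_step_nth:
  "1 \<le> k \<Longrightarrow> level_step x y k $ i = (if k \<le> \<bar>y $ i - x $ i\<bar> then sgn (y $ i - x $ i) else 0)"
  by (auto simp: level_step_def char_vec_def A_set_def B_set_def indicator_def sgn_if)

text \<open>Coordinatewise, a partial step goes from \<open>x\<close> toward \<open>y\<close> by the number of chosen levels that do
  not exceed the distance in that coordinate.  All later facts about partial steps reduce to counting
  levels by this formula.\<close>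

lemma partial_step_nth:
  assumes "J \<subseteq> {1..m}"
  shows "partial_step x y J $ i = sgn (y $ i - x $ i) * int (card (J \<inter> {1..\<bar>y $ i - x $ i\<bar>}))"
proof -
  have fin: "finite J" using assms finite_subset by blast
  have "partial_step x y J $ i = (\<Sum>k\<in>J. level_step x y k $ i)"
    by (simp add: partial_step_def)
  also have "\<dots> = (\<Sum>k\<in>J. if k \<in> {1..\<bar>y $ i - x $ i\<bar>} then sgn (y $ i - x $ i) else 0)"
    using assms by (intro sum.cong) (auto simp: level_step_nth)
  also have "\<dots> = (\<Sum>k\<in>J \<inter> {1..\<bar>y $ i - x $ i\<bar>}. sgn (y $ i - x $ i))"
    using fin by (rule sum.inter_restrict[symmetric])
  finally show ?thesis by simp
qed

lemma partial_step_empty [simp]: "partial_step x y {} = 0"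
  by (simp add: partial_step_def)

lemma partial_step_singleton: "partial_step x y {k} = level_step x y k"
  by (simp add: partial_step_def)

lemma partial_step_Un:
  "finite S \<Longrightarrow> finite T \<Longrightarrow> S \<inter> T = {} \<Longrightarrow>
    partial_step x y (S \<union> T) = partial_step x y S + partial_step x y T"
  by (simp add: partial_step_def sum.union_disjoint)

lemma partial_step_Diff:
  "finite T \<Longrightarrow> S \<subseteq> T \<Longrightarrow> partial_step x y (T - S) = partial_step x y T - partial_step x y S"
  by (simp add: partial_step_def sum_diff)

lemma partial_step_all: "partial_step x y {1..linf_norm (y - x)} = y - x"
proof (rule vec_eq_iff[THEN iffD2], rule allI)
  fix i
  have levels: "{1..linf_norm (y - x)} \<inter> {1..\<bar>y $ i - x $ i\<bar>} = {1..\<bar>y $ i - x $ i\<bar>}"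
    using abs_nth_le_linf_norm[of "y - x" i] by auto
  show "partial_step x y {1..linf_norm (y - x)} $ i = (y - x) $ i"
    unfolding partial_step_nth[OF order_refl] levels by (simp add: sgn_mult_abs)
qed

section \<open>The directed midpoint as a partial step\<close>

lemma card_even_upto: "0 \<le> n \<Longrightarrow> int (card ({k. even k} \<inter> {1..n})) = n div 2" for n :: int
proof (induction n rule: int_ge_induct)
  case base
  then show ?case by simp
next
  case (step n)
  have "{1..n + 1} = insert (n + 1) {1..n}" using step.hyps by auto
  then have "{k. even k} \<inter> {1..n + 1} =
      (if even (n + 1) then insert (n + 1) ({k. even k} \<inter> {1..n}) else {k. even k} \<inter> {1..n})"
    by auto
  then show ?case using step by (auto elim!: oddE evenE)
qed

definition even_levels :: "int ^ 'n \<Rightarrow> int ^ 'n \<Rightarrow> int set" where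
  "even_levels x y = {k. even k} \<inter> {1..linf_norm (y - x)}"

text \<open>Ceiling and floor are chosen so that the rounding is toward \<open>a\<close>, which means that the step
  leaving \<open>a\<close> is rounded toward zero.  Splitting it into sign and absolute value makes it
  comparable with \<open>partial_step_nth\<close>.\<close>

lemma half_toward_zero:
  fixes a b :: int
  shows "(if a \<ge> b then \<lceil>(real_of_int a + real_of_int b) / 2\<rceil>
          else \<lfloor>(real_of_int a + real_of_int b) / 2\<rfloor>) = a + sgn (b - a) * (\<bar>b - a\<bar> div 2)"
proof -
  have fl: "\<lfloor>(real_of_int a + real_of_int b) / 2\<rfloor> = (a + b) div 2"
    using floor_divide_of_int_eq[of "a + b" 2, where ?'a = real] by simp
  \<comment> \<open>the ceiling as a negated floor, so that both roundings become integer division\<close>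
  have ce: "\<lceil>(real_of_int a + real_of_int b) / 2\<rceil> = - ((- a - b) div 2)"
    using floor_divide_of_int_eq[of "- a - b" 2, where ?'a = real]
    by (simp add: ceiling_def minus_divide_left)
  show ?thesis unfolding fl ce by (auto simp: sgn_if)
qed

lemma partial_step_even_levels_nth:
  "partial_step x y (even_levels x y) $ i = sgn (y $ i - x $ i) * (\<bar>y $ i - x $ i\<bar> div 2)"
proof -
  have "even_levels x y \<inter> {1..\<bar>y $ i - x $ i\<bar>} = {k. even k} \<inter> {1..\<bar>y $ i - x $ i\<bar>}"
    using abs_nth_le_linf_norm[of "y - x" i] by (auto simp: even_levels_def)
  then show ?thesis
    using partial_step_nth[of "even_levels x y" "linf_norm (y - x)" x y i]
    by (simp add: card_even_upto even_levels_def)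
qed

lemma mu_eq_partial_step: "mu x y = x + partial_step x y (even_levels x y)"
  by (simp add: vec_eq_iff mu_def half_toward_zero partial_step_even_levels_nth)

lemma mu_swap_eq_partial_step: "mu y x = y - partial_step x y (even_levels x y)"
  by (simp add: vec_eq_iff mu_def half_toward_zero partial_step_even_levels_nth
      abs_minus_commute sgn_if)

section \<open>Renumbering levels between intermediate points\<close>

text \<open>The elements of \<open>W\<close> whose position in the increasing enumeration of \<open>W\<close>, counted from 1, lies
  in \<open>K\<close>.  The position of \<open>k\<close> is the number of elements of \<open>W\<close> up to \<open>k\<close>; this avoids
  an explicit enumeration.  It is meant for sets \<open>W\<close> of positive integers.\<close>

definition pick :: "int set \<Rightarrow> int set \<Rightarrow> int set" where
  "pick W K = {k \<in> W. int (card (W \<inter> {1..k})) \<in> K}"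

text \<open>Positions of the elements of \<open>W\<close> up to \<open>n\<close> run through exactly \<open>1, ..., c\<close>, where \<open>c\<close> is
  the number of these elements.  Induction on \<open>n\<close>: when \<open>n + 1\<close> belongs to \<open>W\<close> it occupies the
  position \<open>c + 1\<close>.\<close>

lemma card_pick_upto:
  assumes W: "W \<subseteq> {1..m}" and "0 \<le> n"
  shows "card (pick W K \<inter> {1..n}) = card (K \<inter> {1..int (card (W \<inter> {1..n}))})"
  using \<open>0 \<le> n\<close>
proof (induction n rule: int_ge_induct)
  case base
  then show ?case by simp
next
  case (step n)
  have ins: "{1..n + 1} = insert (n + 1) {1..n}" using step.hyps by auto
  show ?case
  proof (cases "n + 1 \<in> W")
    case False
    then have "pick W K \<inter> {1..n + 1} = pick W K \<inter> {1..n}" "W \<inter> {1..n + 1} = W \<inter> {1..n}"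
      by (auto simp: ins pick_def)
    with step.IH show ?thesis by simp
  next
    case True
    define c where "c = int (card (W \<inter> {1..n}))"
    have Wins: "W \<inter> {1..n + 1} = insert (n + 1) (W \<inter> {1..n})" using True by (auto simp: ins)
    then have c1: "int (card (W \<inter> {1..n + 1})) = c + 1"
      by (simp add: c_def)
    then have mem: "n + 1 \<in> pick W K \<longleftrightarrow> c + 1 \<in> K" using True by (simp add: pick_def)
    have "{1..c + 1} = insert (c + 1) {1..c}" unfolding c_def by auto
    then have "card (K \<inter> {1..c + 1}) =
        (if c + 1 \<in> K then Suc (card (K \<inter> {1..c})) else card (K \<inter> {1..c}))"
      by (auto simp: Int_insert_right)
    moreover have "card (pick W K \<inter> {1..n + 1}) =
        (if c + 1 \<in> K then Suc (card (pick W K \<inter> {1..n})) else card (pick W K \<inter> {1..n}))"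
      using mem unfolding ins by (auto simp: Int_insert_right)
    ultimately show ?thesis using step.IH unfolding c1 c_def by simp
  qed
qed

lemma pick_subset: "pick W K \<subseteq> W"
  by (auto simp: pick_def)

lemma card_pick:
  assumes W: "W \<subseteq> {1..m}" and K: "K \<subseteq> {1..int (card W)}"
  shows "card (pick W K) = card K"
proof (cases "0 \<le> m")
  case True
  have "pick W K \<inter> {1..m} = pick W K" "W \<inter> {1..m} = W" "K \<inter> {1..int (card W)} = K"
    using assms pick_subset[of W K] by auto
  with card_pick_upto[OF W True, of K] show ?thesis by simp
next
  case False
  then have "W = {}" using W by auto
  with K show ?thesis by (auto simp: pick_def)
qed

lemma relevel_diff:
  assumes "S \<subseteq> T" "T \<subseteq> {1..m}"
  shows "(x + partial_step x y T) - (x + partial_step x y S) = partial_step x y (T - S)"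
  using assms by (simp add: partial_step_Diff finite_subset[OF assms(2)])

text \<open>A coordinate in which the distance of \<open>x\<close> and \<open>y\<close> is attained sees all the levels in \<open>W\<close>, and
  no coordinate sees more.\<close>

lemma linf_norm_partial_step:
  assumes W: "W \<subseteq> {1..linf_norm (y - x)}"
  shows "linf_norm (partial_step x y W) = int (card W)"
proof -
  have fin: "finite W" using W finite_subset by blast
  have le: "\<bar>partial_step x y W $ i\<bar> \<le> int (card W)" for i
    using card_mono[OF fin, of "W \<inter> {1..\<bar>y $ i - x $ i\<bar>}"]
    by (auto simp: partial_step_nth[OF W] abs_mult sgn_if)
  obtain i where i: "\<bar>y $ i - x $ i\<bar> = linf_norm (y - x)"
    using linf_norm_attained[of "y - x"] by auto
  have "W \<inter> {1..linf_norm (y - x)} = W" using W by auto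
  then have "\<bar>partial_step x y W $ i\<bar> = int (card W)"
    using i W by (auto simp: partial_step_nth[OF W] abs_mult sgn_if)
  with le show ?thesis
    by (metis linf_norm_attained abs_nth_le_linf_norm order_antisym)
qed

text \<open>The pair of points belonging to \<open>S\<close> and \<open>T\<close> differs in coordinate \<open>i\<close> by the number of
  levels of \<open>T - S\<close> up to the original difference.  Hence its \<open>k\<close>-th level is the \<open>k\<close>-th element
  of \<open>T - S\<close> as a level of \<open>x\<close> and \<open>y\<close>, which lets any hypothesis on all pairs of
  points be applied inside the lattice of subsets of levels of one pair.\<close>

lemma partial_step_relevel:
  fixes x y :: "int ^ 'n"
  assumes S: "S \<subseteq> T" and T: "T \<subseteq> {1..linf_norm (y - x)}"
    and K: "K \<subseteq> {1..int (card (T - S))}"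
  shows "partial_step (x + partial_step x y S) (x + partial_step x y T) K
    = partial_step x y (pick (T - S) K)" (is "partial_step ?x ?y K = _")
proof (rule vec_eq_iff[THEN iffD2], rule allI)
  fix i
  define n where "n = \<bar>y $ i - x $ i\<bar>"
  have W: "T - S \<subseteq> {1..linf_norm (y - x)}" using T by auto
  have pW: "pick (T - S) K \<subseteq> {1..linf_norm (y - x)}" using W pick_subset by blast
  have "?y $ i - ?x $ i = partial_step x y (T - S) $ i"
    using arg_cong[OF relevel_diff[OF S T, of x y], of "\<lambda>v. v $ i"] by simp
  then have d: "?y $ i - ?x $ i = sgn (y $ i - x $ i) * int (card ((T - S) \<inter> {1..n}))"
    by (simp add: partial_step_nth[OF W] n_def)
  have abs_d: "\<bar>?y $ i - ?x $ i\<bar> = int (card ((T - S) \<inter> {1..n}))"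
    unfolding d by (auto simp: abs_mult sgn_if n_def)
  have "partial_step ?x ?y K $ i =
      sgn (?y $ i - ?x $ i) * int (card (K \<inter> {1..int (card ((T - S) \<inter> {1..n}))}))"
    unfolding partial_step_nth[OF K] abs_d ..
  \<comment> \<open>the sign can change only if the new difference is 0, and then no level is counted\<close>
  also have "\<dots> = sgn (y $ i - x $ i) * int (card (K \<inter> {1..int (card ((T - S) \<inter> {1..n}))}))"
    unfolding d by (cases "card ((T - S) \<inter> {1..n}) = 0") (auto simp: sgn_mult)
  also have "\<dots> = sgn (y $ i - x $ i) * int (card (pick (T - S) K \<inter> {1..n}))"
    using card_pick_upto[OF W, of n K] by (simp add: n_def)
  also have "\<dots> = partial_step x y (pick (T - S) K) $ i"
    by (simp add: partial_step_nth[OF pW] n_def)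
  finally show "partial_step ?x ?y K $ i = partial_step x y (pick (T - S) K) $ i" .
qed

lemma relevel_points:
  fixes x y :: "int ^ 'n"
  assumes S: "S \<subseteq> T" and T: "T \<subseteq> {1..linf_norm (y - x)}"
    and K: "K \<subseteq> {1..int (card (T - S))}"
  defines "x' \<equiv> x + partial_step x y S" and "y' \<equiv> x + partial_step x y T"
  shows "x' + partial_step x' y' K = x + partial_step x y (S \<union> pick (T - S) K)"
    and "y' - partial_step x' y' K = x + partial_step x y (T - pick (T - S) K)"
proof -
  have "finite T" using T by (rule finite_subset) simp
  then have fin: "finite T" "finite S" using S by (auto intro: finite_subset)
  have "finite (pick (T - S) K)" "pick (T - S) K \<subseteq> T" "S \<inter> pick (T - S) K = {}"
    using fin by (auto simp: pick_def)
  then show "x' + partial_step x' y' K = x + partial_step x y (S \<union> pick (T - S) K)"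
    and "y' - partial_step x' y' K = x + partial_step x y (T - pick (T - S) K)"
    unfolding x'_def y'_def partial_step_relevel[OF S T K]
    using fin by (simp_all add: partial_step_Un partial_step_Diff)
qed

section \<open>Filling in all intermediate points\<close>

text \<open>If \<open>E\<close> splits \<open>[S, T]\<close>, the shorter intervals from \<open>S\<close> to \<open>S \<union> E\<close> and from \<open>S \<union> E\<close> to
  \<open>T\<close> consist of members by induction.  They contain \<open>U \<inter> (S \<union> E)\<close> and \<open>U \<union> (S \<union> E)\<close>,
  between which \<open>U\<close> lies.  These two bounds are again closer together than \<open>S\<close> and \<open>T\<close>, unless
  \<open>U\<close> is the complement \<open>T - E\<close> of \<open>S \<union> E\<close> in the interval, and that set is a member by
  assumption.\<close>

lemma interval_closed_of_splitting:
  assumes fin: "finite M"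
    and split: "\<And>S T. S \<in> D \<Longrightarrow> T \<in> D \<Longrightarrow> S \<subseteq> T \<Longrightarrow> T \<subseteq> M \<Longrightarrow> 2 \<le> card (T - S) \<Longrightarrow>
      \<exists>E. E \<noteq> {} \<and> E \<subset> T - S \<and> S \<union> E \<in> D \<and> T - E \<in> D"
    and "S \<in> D" "T \<in> D" "S \<subseteq> U" "U \<subseteq> T" "T \<subseteq> M"
  shows "U \<in> D"
  using assms(3-)
proof (induction "card (T - S)" arbitrary: S T U rule: less_induct)
  case less
  have fT: "finite T" using less.prems(5) fin finite_subset by blast
  show ?case
  proof (cases "2 \<le> card (T - S)")
    case False
    have "U = S \<or> U = T"
    proof (rule ccontr)
      assume "\<not> (U = S \<or> U = T)"
      then obtain a b where "a \<in> U" "a \<notin> S" "b \<in> T" "b \<notin> U" using less.prems(3,4) by blast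
      then have "{a, b} \<subseteq> T - S" "a \<noteq> b" using less.prems(3,4) by auto
      with card_mono[of "T - S" "{a, b}"] fT have "2 \<le> card (T - S)" by simp
      with False show False by simp
    qed
    with less.prems show ?thesis by auto
  next
    case True
    then obtain E where E: "E \<noteq> {}" "E \<subset> T - S" "S \<union> E \<in> D" "T - E \<in> D"
      using split less.prems by (meson order_trans)
    have smaller: "card W < card (T - S)" if "W \<subset> T - S" for W
      using that fT by (simp add: psubset_card_mono)
    have low: "U \<inter> (S \<union> E) \<in> D"
      by (rule less.hyps[of "S \<union> E" S]) (use E less.prems in \<open>auto intro!: smaller\<close>)
    have high: "U \<union> (S \<union> E) \<in> D"
      by (rule less.hyps[of T "S \<union> E"]) (use E less.prems in \<open>auto intro!: smaller\<close>)
    show ?thesis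
    proof (cases "U = T - E")
      case True
      with E show ?thesis by simp
    next
      case False
      have "(U \<union> (S \<union> E)) - (U \<inter> (S \<union> E)) \<subset> T - S"
        using False E less.prems by blast
      then show ?thesis
        by (intro less.hyps[OF smaller low high]) (use E less.prems in auto)
    qed
  qed
qed

text \<open>The geometric form of the preceding lemma: the condition on all pairs of points of \<open>D\<close> becomes,
  through renumbering, a splitting condition on the family of those sets of levels whose partial
  steps stay in \<open>D\<close>.\<close>

lemma partial_steps_in_set:
  fixes D :: "(int ^ 'n) set"
  assumes split: "\<And>x y. x \<in> D \<Longrightarrow> y \<in> D \<Longrightarrow> 2 \<le> linf_norm (y - x) \<Longrightarrow>
      \<exists>K \<subseteq> {1..linf_norm (y - x)}. 0 < card K \<and> int (card K) < linf_norm (y - x) \<and>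
        x + partial_step x y K \<in> D \<and> y - partial_step x y K \<in> D"
    and x: "x \<in> D" and y: "y \<in> D" and J: "J \<subseteq> {1..linf_norm (y - x)}"
  shows "x + partial_step x y J \<in> D"
proof -
  define M where "M = {1..linf_norm (y - x)}"
  define DD where "DD = {S. x + partial_step x y S \<in> D}"
  have "J \<in> DD"
  proof (rule interval_closed_of_splitting[of M DD "{}" M J])
    fix S T
    assume ST: "S \<in> DD" "T \<in> DD" "S \<subseteq> T" "T \<subseteq> M" "2 \<le> card (T - S)"
    have TM: "T \<subseteq> {1..linf_norm (y - x)}" and WM: "T - S \<subseteq> {1..linf_norm (y - x)}"
      using ST by (auto simp: M_def)
    have norm: "linf_norm ((x + partial_step x y T) - (x + partial_step x y S)) = int (card (T - S))"
      unfolding relevel_diff[OF ST(3) TM] using WM by (rule linf_norm_partial_step)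
    obtain K where K: "K \<subseteq> {1..int (card (T - S))}" "0 < card K" "card K < card (T - S)"
      and mem: "x + partial_step x y S +
          partial_step (x + partial_step x y S) (x + partial_step x y T) K \<in> D"
        "x + partial_step x y T -
          partial_step (x + partial_step x y S) (x + partial_step x y T) K \<in> D"
      using split[of "x + partial_step x y S" "x + partial_step x y T"] ST(1,2,5)
      unfolding norm DD_def by auto
    have "pick (T - S) K \<noteq> {}" "pick (T - S) K \<noteq> T - S"
      using card_pick[OF WM K(1)] K(2,3) by auto
    then show "\<exists>E. E \<noteq> {} \<and> E \<subset> T - S \<and> S \<union> E \<in> DD \<and> T - E \<in> DD"
      using mem pick_subset[of "T - S" K]
      unfolding relevel_points[OF ST(3) TM K(1)] DD_def by blast
  qed (use x y J in \<open>auto simp: M_def DD_def partial_step_all\<close>)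
  then show ?thesis by (simp add: DD_def)
qed

section \<open>From local to global supermodularity\<close>

text \<open>Adding the elements of \<open>B\<close> one at a time makes the local inequalities for a single \<open>a\<close>
  telescope; adding the elements of \<open>A\<close> one at a time makes the resulting inequalities telescope
  again.  The function is real-valued because telescoping cancels terms, which infinite values
  do not permit.\<close>

lemma supermodular_of_local:
  fixes g :: "'a set \<Rightarrow> real"
  assumes fin: "finite M"
    and loc: "\<And>S a b. insert a (insert b S) \<subseteq> M \<Longrightarrow> a \<noteq> b \<Longrightarrow> a \<notin> S \<Longrightarrow> b \<notin> S \<Longrightarrow>
      g (insert a S) + g (insert b S) \<le> g S + g (insert a (insert b S))"
    and "A \<subseteq> M" "B \<subseteq> M" "A \<inter> B = {}"
  shows "g A + g B \<le> g {} + g (A \<union> B)"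
proof -
  have one: "g (insert a S) + g (S \<union> B) \<le> g S + g (insert a (S \<union> B))"
    if "insert a (S \<union> B) \<subseteq> M" "a \<notin> S" "a \<notin> B" "S \<inter> B = {}" for a S B
  proof -
    have "finite B" using that(1) by (intro finite_subset[OF _ fin]) auto
    then show ?thesis using that
    proof (induction B rule: finite_induct)
      case empty
      then show ?case by simp
    next
      case (insert b B)
      have "g (insert a (S \<union> B)) + g (insert b (S \<union> B))
          \<le> g (S \<union> B) + g (insert a (insert b (S \<union> B)))"
        using insert by (intro loc) auto
      moreover have "g (insert a S) + g (S \<union> B) \<le> g S + g (insert a (S \<union> B))"
        using insert by auto
      ultimately show ?case by simp
    qed
  qed
  have "finite A" using assms(3) fin by (rule finite_subset)
  then show ?thesis using assms(3-)
  proof (induction A rule: finite_induct)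
    case empty
    then show ?case by simp
  next
    case (insert a A)
    then have "g A + g B \<le> g {} + g (A \<union> B)" by auto
    moreover have "g (insert a A) + g (A \<union> B) \<le> g A + g (insert a (A \<union> B))"
      using insert by (intro one) auto
    ultimately show ?case by simp
  qed
qed

section \<open>Exchange inequalities\<close>

definition exchange :: "(int ^ 'n \<Rightarrow> ereal) \<Rightarrow> int ^ 'n \<Rightarrow> int ^ 'n \<Rightarrow> int set \<Rightarrow> bool" where
  "exchange f x y J \<longleftrightarrow>
    f (x + partial_step x y J) + f (y - partial_step x y J) \<le> f x + f y"

text \<open>Without the value \<open>-\<infinity>\<close>, a finite bound on a sum bounds both summands: this is how an
  inequality between function values yields membership in the domain.\<close>

lemma dominated_pair_in_domain:
  assumes "\<And>x. f x \<noteq> -\<infinity>" "x \<in> effective_domain f" "y \<in> effective_domain f" "f u + f v \<le> f x + f y"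
  shows "u \<in> effective_domain f \<and> v \<in> effective_domain f"
proof -
  have "f x + f y < \<infinity>" using assms(2,3) by (auto simp: effective_domain_def less_top[symmetric])
  then have "f u + f v < \<infinity>" using assms(4) by (rule order.strict_trans1[rotated])
  then show ?thesis using assms(1)[of u] assms(1)[of v] by (auto simp: effective_domain_def)
qed

lemma exchange_outside_domain:
  assumes "\<And>x. f x \<noteq> -\<infinity>" "\<not> (x \<in> effective_domain f \<and> y \<in> effective_domain f)"
  shows "exchange f x y J"
proof -
  have "f x + f y = \<infinity>" using assms by (auto simp: effective_domain_def)
  then show ?thesis unfolding exchange_def by (simp only: ereal_less_eq(1))
qed

lemma mu_ineq_iff_exchange: "f (mu x y) + f (mu y x) \<le> f x + f y \<longleftrightarrow> exchange f x y (even_levels x y)"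
  unfolding exchange_def mu_eq_partial_step[of x y] mu_swap_eq_partial_step[of y x] ..

lemma even_levels_norm_2: "linf_norm (y - x) = 2 \<Longrightarrow> even_levels x y = {2}"
proof -
  have "{1..2} = {1, 2::int}" by auto
  then show "linf_norm (y - x) = 2 \<Longrightarrow> even_levels x y = {2}"
    by (auto simp: even_levels_def)
qed

lemma card_even_levels: "int (card (even_levels x y)) = linf_norm (y - x) div 2"
  by (simp add: even_levels_def card_even_upto linf_norm_nonneg)

text \<open>Closure of the domain under \<open>mu\<close> makes \<open>f\<close> finite at all points reached by partial steps,
  since the even levels split every pair at distance at least 2 properly.  As a function of the
  set of levels, \<open>f\<close> is then locally supermodular by the inequality at distance 2.\<close>

lemma exchange_of_norm_2:
  fixes f :: "int ^ 'n \<Rightarrow> ereal"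
  assumes proper: "\<And>x. f x \<noteq> -\<infinity>"
    and dom: "DDM_convex_set (effective_domain f)"
    and two: "\<And>x y. linf_norm (y - x) = 2 \<Longrightarrow> exchange f x y {2}"
    and x: "x \<in> effective_domain f" and y: "y \<in> effective_domain f"
    and J: "J \<subseteq> {1..linf_norm (y - x)}"
  shows "exchange f x y J"
proof -
  define M where "M = {1..linf_norm (y - x)}"
  define g where "g S = real_of_ereal (f (x + partial_step x y S))" for S
  have mem: "x + partial_step x y S \<in> effective_domain f" if "S \<subseteq> M" for S
  proof (rule partial_steps_in_set[OF _ x y])
    fix u v :: "int ^ 'n"
    assume uv: "u \<in> effective_domain f" "v \<in> effective_domain f" "2 \<le> linf_norm (v - u)"
    have "mu u v \<in> effective_domain f" "mu v u \<in> effective_domain f"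
      using dom uv by (auto simp: DDM_convex_set_def)
    moreover have "0 < int (card (even_levels u v))" "int (card (even_levels u v)) < linf_norm (v - u)"
      using uv(3) unfolding card_even_levels by linarith+
    moreover have "even_levels u v \<subseteq> {1..linf_norm (v - u)}" by (auto simp: even_levels_def)
    ultimately show "\<exists>K \<subseteq> {1..linf_norm (v - u)}. 0 < card K \<and> int (card K) < linf_norm (v - u) \<and>
        u + partial_step u v K \<in> effective_domain f \<and> v - partial_step u v K \<in> effective_domain f"
      unfolding mu_eq_partial_step[of u v] mu_swap_eq_partial_step[of v u] by auto
  qed (use that in \<open>simp add: M_def\<close>)
  have g: "f (x + partial_step x y S) = ereal (g S)" if "S \<subseteq> M" for S
    using mem[OF that] proper by (auto simp: g_def effective_domain_def ereal_real)
  have "g J + g (M - J) \<le> g {} + g (J \<union> (M - J))"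
  proof (rule supermodular_of_local[of M])
    fix S a b
    assume ab: "insert a (insert b S) \<subseteq> M" "a \<noteq> b" "a \<notin> S" "b \<notin> S"
    define T where "T = insert a (insert b S)"
    have T: "S \<subseteq> T" "T \<subseteq> {1..linf_norm (y - x)}" using ab by (auto simp: T_def M_def)
    have W: "T - S = {a, b}" using ab by (auto simp: T_def)
    have cW: "card (T - S) = 2" using ab by (simp add: W)
    have K: "{2} \<subseteq> {1..int (card (T - S))}" by (simp add: cW)
    have TSM: "T - S \<subseteq> {1..linf_norm (y - x)}" using T by auto
    have "linf_norm ((x + partial_step x y T) - (x + partial_step x y S)) = 2"
      unfolding relevel_diff[OF T] linf_norm_partial_step[OF TSM] by (simp add: cW)
    from two[OF this]
    have ineq: "f (x + partial_step x y (S \<union> pick (T - S) {2}))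
          + f (x + partial_step x y (T - pick (T - S) {2}))
        \<le> f (x + partial_step x y S) + f (x + partial_step x y T)"
      unfolding exchange_def relevel_points[OF T K] .
    have "card (pick (T - S) {2}) = 1" using card_pick[OF TSM K] by simp
    \<comment> \<open>whether the top one of the two levels is \<open>a\<close> or \<open>b\<close>, the inequality is the same\<close>
    then obtain c where c: "pick (T - S) {2} = {c}" by (auto simp: card_1_singleton_iff)
    with pick_subset[of "T - S" "{2}"] W have "c = a \<or> c = b" by auto
    then have "S \<union> {c} = insert a S \<and> T - {c} = insert b S \<or> S \<union> {c} = insert b S \<and> T - {c} = insert a S"
      using ab by (auto simp: T_def)
    then have "f (x + partial_step x y (insert a S)) + f (x + partial_step x y (insert b S))
        \<le> f (x + partial_step x y S) + f (x + partial_step x y T)"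
      using ineq unfolding c by (metis add.commute)
    then show "g (insert a S) + g (insert b S) \<le> g S + g (insert a (insert b S))"
      using g[of "insert a S"] g[of "insert b S"] g[of S] g[of T] ab by (simp add: T_def)
  qed (use J in \<open>auto simp: M_def\<close>)
  moreover have JM: "J \<subseteq> M" "J \<union> (M - J) = M" using J by (auto simp: M_def)
  ultimately have "ereal (g J) + ereal (g (M - J)) \<le> ereal (g {}) + ereal (g M)" by simp
  moreover have "f (x + partial_step x y J) = ereal (g J)" using JM(1) by (rule g)
  moreover have "f (y - partial_step x y J) = ereal (g (M - J))"
    using g[of "M - J"] partial_step_Diff[of M J x y] JM(1) partial_step_all[of x y]
    by (simp add: M_def)
  moreover have "f x = ereal (g {})" using g[of "{}"] by simp
  moreover have "f y = ereal (g M)" using g[of M] partial_step_all[of x y] by (simp add: M_def)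
  ultimately show ?thesis by (simp only: exchange_def)
qed

theorem theorem5p1:
  fixes f :: "int ^ 'n \<Rightarrow> ereal"
  assumes "\<And>x. f x \<noteq> -\<infinity>"
  shows
    "(DDM_convex f \<longleftrightarrow>
        DDM_convex_set (effective_domain f) \<and>
        (\<forall>x y. linf_norm (x - y) = 2 \<longrightarrow> f x + f y \<ge> f (mu x y) + f (mu y x))) \<and>
     (DDM_convex f \<longleftrightarrow>
        (\<forall>x \<in> effective_domain f. \<forall>y \<in> effective_domain f. \<forall>J \<subseteq> {1..linf_norm (y - x)}.
          let d = (\<Sum>k\<in>J. char_vec (A_set x y k) - char_vec (B_set x y k))
          in f x + f y \<ge> f (x + d) + f (y - d))) \<and>
     (DDM_convex f \<longleftrightarrow>
        (\<forall>x \<in> effective_domain f. \<forall>y \<in> effective_domain f. x \<noteq> y \<longrightarrow>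
          (let m = linf_norm (y - x)
           in f x + f y \<ge> f (x + char_vec (A_set x y m) - char_vec (B_set x y m))
                        + f (y - char_vec (A_set x y m) + char_vec (B_set x y m))))) \<and>
     (DDM_convex f \<longleftrightarrow>
        (\<forall>x \<in> effective_domain f. \<forall>y \<in> effective_domain f. \<forall>\<alpha> \<in> {1..linf_norm (y - x)}.
          let d = (\<Sum>k=1..\<alpha>. char_vec (A_set x y k) - char_vec (B_set x y k))
          in f x + f y \<ge> f (x + d) + f (y - d)))"
    (is "(_ \<longleftrightarrow> ?P2) \<and> (_ \<longleftrightarrow> ?P3) \<and> (_ \<longleftrightarrow> ?P4) \<and> (_ \<longleftrightarrow> ?P5)")
proof -
  let ?dom = "effective_domain f"
  note outside = exchange_outside_domain[of f, OF assms]
  note endpoints = dominated_pair_in_domain[of f, OF assms]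
  have norm_2: "(linf_norm (x - y) = 2 \<longrightarrow> f (mu x y) + f (mu y x) \<le> f x + f y) \<longleftrightarrow>
      (linf_norm (y - x) = 2 \<longrightarrow> exchange f x y {2})" for x y
    using linf_norm_minus_commute[of x y] even_levels_norm_2[of y x]
    by (auto simp: mu_ineq_iff_exchange)
  have P2: "?P2 \<longleftrightarrow> DDM_convex_set ?dom \<and> (\<forall>x y. linf_norm (y - x) = 2 \<longrightarrow> exchange f x y {2})"
    by (simp add: norm_2)
  have P3: "?P3 \<longleftrightarrow> (\<forall>x \<in> ?dom. \<forall>y \<in> ?dom. \<forall>J \<subseteq> {1..linf_norm (y - x)}. exchange f x y J)"
    by (simp add: exchange_def partial_step_def level_step_def Let_def)
  have P4: "?P4 \<longleftrightarrow> (\<forall>x \<in> ?dom. \<forall>y \<in> ?dom. x \<noteq> y \<longrightarrow> exchange f x y {linf_norm (y - x)})"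
    by (simp add: exchange_def partial_step_singleton level_step_def Let_def algebra_simps)
  have P5: "?P5 \<longleftrightarrow> (\<forall>x \<in> ?dom. \<forall>y \<in> ?dom. \<forall>\<alpha> \<in> {1..linf_norm (y - x)}. exchange f x y {1..\<alpha>})"
    by (simp add: exchange_def partial_step_def level_step_def Let_def)
  have one_two: "?P2" if conv: "DDM_convex f"
    using conv endpoints unfolding DDM_convex_def DDM_convex_set_def by blast
  have two_three: "?P3" if "?P2"
    unfolding P3 using exchange_of_norm_2[of f, OF assms] that[unfolded P2] by blast
  have three_one: "DDM_convex f" if "?P3"
    unfolding DDM_convex_def mu_ineq_iff_exchange
  proof (intro allI)
    fix x y
    show "exchange f x y (even_levels x y)"
    proof (cases "x \<in> ?dom \<and> y \<in> ?dom")
      case True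
      then show ?thesis using that[unfolded P3] by (auto simp: even_levels_def)
    next
      case False
      then show ?thesis by (rule outside)
    qed
  qed
  have three_five: "?P5" if "?P3"
    unfolding P5 using that[unfolded P3] by auto
  have five_four: "?P4" if "?P5"
    unfolding P4
  proof (intro ballI impI)
    fix x y
    assume xy: "x \<in> ?dom" "y \<in> ?dom" "x \<noteq> y"
    define m where "m = linf_norm (y - x)"
    have m: "1 \<le> m" using linf_norm_pos[OF xy(3)] by (simp add: m_def)
    \<comment> \<open>the top level and the initial segment ending at \<open>m - 1\<close> are complementary\<close>
    have "{1..m} - {m} = {1..m - 1}" by auto
    then have lower: "partial_step x y {1..m - 1} = y - x - partial_step x y {m}"
      using partial_step_Diff[of "{1..m}" "{m}" x y] m partial_step_all[of x y] by (simp add: m_def)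
    have "exchange f x y {1..m - 1}"
    proof (cases "m = 1")
      \<comment> \<open>the initial segment is empty and both sides of the inequality agree\<close>
      case True
      then show ?thesis by (simp add: exchange_def)
    next
      case False
      then show ?thesis using that[unfolded P5] xy m by (auto simp: m_def)
    qed
    then show "exchange f x y {linf_norm (y - x)}"
      unfolding exchange_def lower m_def[symmetric] by (simp add: algebra_simps)
  qed
  have four_two: "?P2" if p4: "?P4"
    unfolding P2
  proof (intro conjI allI impI)
    fix x y :: "int ^ 'n"
    assume norm: "linf_norm (y - x) = 2"
    then have "x \<noteq> y" by (auto simp: linf_norm_def)
    then show "exchange f x y {2}"
      using p4[unfolded P4] norm outside[of x y "{2}"] by metis
  next
    \<comment> \<open>the top level splits every pair at distance at least 2 properly\<close>
    have fill: "x + partial_step x y J \<in> ?dom"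
      if xy: "x \<in> ?dom" "y \<in> ?dom" "J \<subseteq> {1..linf_norm (y - x)}" for x y J
    proof (rule partial_steps_in_set[OF _ xy])
      fix u v :: "int ^ 'n"
      assume uv: "u \<in> ?dom" "v \<in> ?dom" "2 \<le> linf_norm (v - u)"
      then have "u \<noteq> v" by (auto simp: linf_norm_def)
      then have "exchange f u v {linf_norm (v - u)}" using p4[unfolded P4] uv by blast
      then have "u + partial_step u v {linf_norm (v - u)} \<in> ?dom \<and>
          v - partial_step u v {linf_norm (v - u)} \<in> ?dom"
        unfolding exchange_def by (rule endpoints[OF uv(1,2)])
      then show "\<exists>K \<subseteq> {1..linf_norm (v - u)}. 0 < card K \<and> int (card K) < linf_norm (v - u) \<and>
          u + partial_step u v K \<in> ?dom \<and> v - partial_step u v K \<in> ?dom"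
        using uv(3) by (intro exI[of _ "{linf_norm (v - u)}"]) auto
    qed
    have "mu x y \<in> ?dom" if "x \<in> ?dom" "y \<in> ?dom" for x y
      unfolding mu_eq_partial_step by (rule fill) (use that in \<open>auto simp: even_levels_def\<close>)
    then show "DDM_convex_set ?dom" by (simp add: DDM_convex_set_def)
  qed
  have implications: "(A \<longleftrightarrow> B) \<and> (A \<longleftrightarrow> C) \<and> (A \<longleftrightarrow> D) \<and> (A \<longleftrightarrow> E)"
    if "A \<Longrightarrow> B" "B \<Longrightarrow> C" "C \<Longrightarrow> A" "C \<Longrightarrow> E" "E \<Longrightarrow> D" "D \<Longrightarrow> B" for A B C D E :: bool
    using that by blast
  show ?thesis
    by (rule implications[OF one_two two_three three_one three_five five_four four_two])
qed

end
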